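(* (a) Let $P$ be a stochastic $n\times n$ matrix all of whose entries are positive, viewed as the transition matrix of a Markov chain on a state space $\Omega$ with $n$ elements. Let $\pi$ be its stationary distribution, let $p_{\min}$ be the minimum entry of $P$, and let $d(t)$ be its distance from stationarity after $t$ steps. Let $0<\epsilon<1$. Then for every positive integer $t$, $$t \ \ge\ \frac{1}{2p_{\min}}\ln\frac{n}{\epsilon}+1 \quad\Longrightarrow\quad d(t)\le \epsilon .$$ (b) There is an absolute constant $C>0$ such that the following holds. Let $Q$ be the transition matrix of an ergodic (irreducible and aperiodic), discrete-time, time-homogeneous Markov chain on a state space with $n$ elements. Let $m=\min\{k\ge 1 : Q^k \text{ has all entries positive}\}$ and let $p_{\min}$ be the minimum entry of $Q^m$. Then for every $0<\epsilon<1$, the mixing time of the chain satisfies $$t_{\rm mix}(\epsilon)\ \le\ C\,\frac{m}{2p_{\min}}\ln\frac{n}{\epsilon}.$$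
   Context: A stochastic matrix is a square matrix with entries in $[0,1]$ each of whose rows sums to $1$. A finite Markov chain with state space $\Omega$ and transition matrix $P$ has $P(x,y)$ as its probability of moving from state $x$ to state $y$ in one step. The transition graph has vertex set $\Omega$ and a directed edge from $x$ to $y$ iff $P(x,y)>0$. The chain is irreducible if this graph is strongly connected, and aperiodic if for every state $s$ the gcd of the lengths of all closed walks (of positive length) from $s$ to $s$ is $1$. It is ergodic if it is both irreducible and aperiodic. For an ergodic chain some power of the transition matrix has all entries positive, so $m$ is well defined. A stationary distribution is a probability (row) vector $\pi$ with $\pi P=\pi$; an ergodic chain has exactly one. For probability distributions $\mu,\nu$ on $\Omega$, the total variation distance is $\|\mu-\nu\|_{\rm TV}=\frac12\sum_{x\in\Omega}|\mu(x)-\nu(x)|$. For a chain with transition matrix $P$ and stationary distribution $\pi$, set $$d(t)=\max_{x\in\Omega}\|P^t(x,\cdot)-\pi\|_{\rm TV},$$ where $P^t(x,\cdot)$ is the row of $P^t$ indexed by $x$. The mixing time within $\epsilon$ is $t_{\rm mix}(\epsilon)=\min\{t\ge 0 : d(t)\le\epsilon\}$, where $t$ ranges over nonnegative integers. *)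

theory Defs
  imports
    Complex_Main
    "Jordan_Normal_Form.Matrix"
    "Graph_Theory.Graph_Theory"
begin

text \<open>
  A finite Markov chain with \<open>n\<close> states is given by its \<open>n \<times> n\<close> transition matrix; the states
  are the indices \<open>0, \<dots>, n - 1\<close>.
\<close>

definition stochastic_mat :: "real mat \<Rightarrow> bool" where
  "stochastic_mat P \<longleftrightarrow> square_mat P \<and>
     (\<forall>x < dim_row P. \<forall>y < dim_row P. 0 \<le> P $$ (x, y) \<and> P $$ (x, y) \<le> 1) \<and>
     (\<forall>x < dim_row P. (\<Sum>y < dim_row P. P $$ (x, y)) = 1)"

definition positive_mat :: "real mat \<Rightarrow> bool" where
  "positive_mat P \<longleftrightarrow> (\<forall>a \<in> elements_mat P. 0 < a)"

definition min_entry :: "real mat \<Rightarrow> real" where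
  "min_entry P = Min (elements_mat P)"

definition transition_graph :: "real mat \<Rightarrow> nat pair_pre_digraph" where
  "transition_graph P =
     \<lparr> pverts = {..< dim_row P},
       parcs = {(x, y). x < dim_row P \<and> y < dim_row P \<and> 0 < P $$ (x, y)} \<rparr>"

definition irreducible_chain :: "real mat \<Rightarrow> bool" where
  "irreducible_chain P \<longleftrightarrow> strongly_connected (with_proj (transition_graph P))"

definition aperiodic_chain :: "real mat \<Rightarrow> bool" where
  "aperiodic_chain P \<longleftrightarrow>
     (\<forall>s < dim_row P.
        Gcd {length w | w. pre_digraph.awalk (with_proj (transition_graph P)) s w s \<and> w \<noteq> []} = 1)"

definition ergodic_chain :: "real mat \<Rightarrow> bool" where
  "ergodic_chain P \<longleftrightarrow> stochastic_mat P \<and> irreducible_chain P \<and> aperiodic_chain P"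

definition is_stationary_dist :: "real mat \<Rightarrow> real vec \<Rightarrow> bool" where
  "is_stationary_dist P \<pi> \<longleftrightarrow>
     \<pi> \<in> carrier_vec (dim_row P) \<and>
     (\<forall>x < dim_row P. 0 \<le> \<pi> $ x) \<and> (\<Sum>x < dim_row P. \<pi> $ x) = 1 \<and>
     mat_of_row \<pi> * P = mat_of_row \<pi>"

text \<open>
  Meaningful only when there is exactly one stationary distribution, as for ergodic chains.
\<close>
definition stationary_dist :: "real mat \<Rightarrow> real vec" where
  "stationary_dist P = (THE \<pi>. is_stationary_dist P \<pi>)"

definition tv_dist :: "real vec \<Rightarrow> real vec \<Rightarrow> real" where
  "tv_dist \<mu> \<nu> = 1 / 2 * (\<Sum>x < dim_vec \<mu>. \<bar>\<mu> $ x - \<nu> $ x\<bar>)"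

definition dist_from_stationarity :: "real mat \<Rightarrow> nat \<Rightarrow> real" where
  "dist_from_stationarity P t =
     Max ((\<lambda>x. tv_dist (row (P ^\<^sub>m t) x) (stationary_dist P)) ` {..< dim_row P})"

definition mixing_time :: "real mat \<Rightarrow> real \<Rightarrow> nat" where
  "mixing_time P \<epsilon> = (LEAST t. dist_from_stationarity P t \<le> \<epsilon>)"

definition positivity_exponent :: "real mat \<Rightarrow> nat" where
  "positivity_exponent Q = (LEAST k. 1 \<le> k \<and> positive_mat (Q ^\<^sub>m k))"

end

theory Submission
  imports Defs "Jordan_Normal_Form.Determinant"
begin

text \<open>
  Doeblin's argument: if all entries of a stochastic \<open>n \<times> n\<close> matrix \<open>P\<close> are at least \<open>p\<close>, then
  \<open>v \<mapsto> v P\<close> contracts the \<open>\<ell>\<^sup>1\<close> norm of row vectors with zero sum by the factor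
  \<open>1 - n p\<close>. Hence \<open>d(t) \<le> (1 - n p)\<^sup>t \<le> exp (-2 p t)\<close> for \<open>n \<ge> 2\<close>. For an ergodic chain this
  applies to the first positive power \<open>Q\<^sup>m\<close>, and \<open>p \<le> 1/2\<close> lets a constant absorb the rounding
  of \<open>t\<close> to an integer.
\<close>

section \<open>Stochastic matrices\<close>

lemma pow_mat_add:
  fixes A :: "'a :: semiring_1 mat"
  assumes "A \<in> carrier_mat n n"
  shows "A ^\<^sub>m (k + l) = A ^\<^sub>m k * A ^\<^sub>m l"
proof (induction l)
  case 0
  show ?case using assms by simp
next
  case (Suc l)
  then show ?case
    using assms assoc_mult_mat[of "A ^\<^sub>m k" n n "A ^\<^sub>m l" n A n] by simp
qed

lemma pow_mat_mult:
  fixes A :: "'a :: semiring_1 mat"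
  assumes "A \<in> carrier_mat n n"
  shows "A ^\<^sub>m (k * l) = (A ^\<^sub>m k) ^\<^sub>m l"
proof (induction l)
  case 0
  show ?case using assms by simp
next
  case (Suc l)
  have "A ^\<^sub>m (k * Suc l) = A ^\<^sub>m (k * l + k)" by (simp add: add.commute)
  then show ?case using Suc by (simp only: pow_mat_add[OF assms] pow_mat.simps)
qed

lemma index_mult_mat_sum:
  assumes "A \<in> carrier_mat nr n" "B \<in> carrier_mat n nc" "i < nr" "j < nc"
  shows "(A * B) $$ (i, j) = (\<Sum>k<n. A $$ (i, k) * B $$ (k, j))"
  using assms by (simp add: scalar_prod_def lessThan_atLeast0)

lemma stochastic_matD:
  assumes "stochastic_mat P" "P \<in> carrier_mat n n"
  shows "x < n \<Longrightarrow> y < n \<Longrightarrow> 0 \<le> P $$ (x, y)" "x < n \<Longrightarrow> (\<Sum>y<n. P $$ (x, y)) = 1"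
  using assms by (auto simp: stochastic_mat_def)

lemma stochastic_matI:
  assumes "P \<in> carrier_mat n n"
    and "\<And>x y. x < n \<Longrightarrow> y < n \<Longrightarrow> 0 \<le> P $$ (x, y)"
    and "\<And>x. x < n \<Longrightarrow> (\<Sum>y<n. P $$ (x, y)) = 1"
  shows "stochastic_mat P"
proof -
  have "P $$ (x, y) \<le> 1" if "x < n" "y < n" for x y
    using member_le_sum[of y "{..<n}" "\<lambda>y. P $$ (x, y)"] assms that by simp
  then show ?thesis using assms by (auto simp: stochastic_mat_def)
qed

lemma stochastic_mat_mult:
  assumes A: "stochastic_mat A" "A \<in> carrier_mat n n" and B: "stochastic_mat B" "B \<in> carrier_mat n n"
  shows "stochastic_mat (A * B)"
proof (rule stochastic_matI)
  show "A * B \<in> carrier_mat n n" using A B by simp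
next
  fix x y assume "x < n" "y < n"
  then show "0 \<le> (A * B) $$ (x, y)"
    unfolding index_mult_mat_sum[OF A(2) B(2) \<open>x < n\<close> \<open>y < n\<close>]
    by (intro sum_nonneg mult_nonneg_nonneg) (auto intro: stochastic_matD A B)
next
  fix x assume x: "x < n"
  have "(\<Sum>y<n. (A * B) $$ (x, y)) = (\<Sum>y<n. \<Sum>k<n. A $$ (x, k) * B $$ (k, y))"
    by (intro sum.cong refl) (use x index_mult_mat_sum[OF A(2) B(2)] in auto)
  also have "\<dots> = (\<Sum>k<n. A $$ (x, k) * (\<Sum>y<n. B $$ (k, y)))"
    by (subst sum.swap) (simp add: sum_distrib_left)
  also have "\<dots> = 1"
    using stochastic_matD(2)[OF B] stochastic_matD(2)[OF A x] by simp
  finally show "(\<Sum>y<n. (A * B) $$ (x, y)) = 1" .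
qed

lemma stochastic_mat_pow:
  assumes "stochastic_mat P" "P \<in> carrier_mat n n"
  shows "stochastic_mat (P ^\<^sub>m t)"
proof (induction t)
  case 0
  have "stochastic_mat (1\<^sub>m n)" by (rule stochastic_matI) auto
  then show ?case using assms by simp
next
  case (Suc t)
  then show ?case
    using stochastic_mat_mult[of "P ^\<^sub>m t" n P] assms by simp
qed

lemma finite_elements_mat: "finite (elements_mat A)"
  by (simp add: elements_mat_def)

lemma min_entry_le:
  assumes "P \<in> carrier_mat n n" "x < n" "y < n"
  shows "min_entry P \<le> P $$ (x, y)"
  unfolding min_entry_def using assms by (intro Min_le finite_elements_mat) auto

lemma min_entry_pos:
  assumes "positive_mat P" "P \<in> carrier_mat n n" "1 \<le> n"
  shows "0 < min_entry P"
proof -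
  have "P $$ (0, 0) \<in> elements_mat P" using elements_matI[OF assms(2), of 0 0] assms(3) by simp
  then have "min_entry P \<in> elements_mat P"
    unfolding min_entry_def by (intro Min_in finite_elements_mat) auto
  then show ?thesis using assms(1) by (simp add: positive_mat_def)
qed

text \<open>The \<open>n\<close> entries of row 0 sum to 1. This makes the contraction factor
  \<open>1 - n p\<close> nonnegative and gives \<open>p \<le> 1/2\<close> once
  \<open>n \<ge> 2\<close>.\<close>

lemma min_entry_le_inverse_dim:
  assumes "stochastic_mat P" "P \<in> carrier_mat n n" "1 \<le> n"
  shows "real n * min_entry P \<le> 1"
proof -
  have "real n * min_entry P = (\<Sum>y<n. min_entry P)" by simp
  also have "\<dots> \<le> (\<Sum>y<n. P $$ (0, y))"
    using assms by (intro sum_mono min_entry_le) auto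
  also have "\<dots> = 1" using stochastic_matD(2)[OF assms(1,2)] assms(3) by simp
  finally show ?thesis .
qed

section \<open>Contraction of the row action\<close>

text \<open>The row vector \<open>v P\<close>, with vectors encoded as functions on the states.\<close>

definition push :: "real mat \<Rightarrow> (nat \<Rightarrow> real) \<Rightarrow> nat \<Rightarrow> real" where
  "push P v j = (\<Sum>i<dim_row P. v i * P $$ (i, j))"

lemma push_mult:
  assumes "A \<in> carrier_mat n n" "B \<in> carrier_mat n n" "j < n"
  shows "push (A * B) v j = push B (push A v) j"
proof -
  have "push (A * B) v j = (\<Sum>i<n. \<Sum>k<n. v i * (A $$ (i, k) * B $$ (k, j)))"
    unfolding push_def sum_distrib_left[symmetric]
    using assms by (intro sum.cong) (auto simp: index_mult_mat_sum simp del: index_mult_mat(1))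
  also have "\<dots> = (\<Sum>k<n. \<Sum>i<n. v i * (A $$ (i, k) * B $$ (k, j)))"
    by (rule sum.swap)
  also have "\<dots> = push B (push A v) j"
    using assms by (simp add: push_def sum_distrib_right mult.assoc)
  finally show ?thesis .
qed

lemma push_diff: "push P (\<lambda>i. v i - w i) j = push P v j - push P w j"
  by (simp add: push_def left_diff_distrib sum_subtractf)

lemma push_cong:
  assumes "\<And>i. i < dim_row P \<Longrightarrow> v i = w i"
  shows "push P v j = push P w j"
  using assms by (simp add: push_def)

text \<open>Row sums equal to 1 preserve total mass. In particular zero-sum vectors stay zero-sum,
  so the contraction can be iterated.\<close>

lemma sum_push:
  assumes "stochastic_mat P" "P \<in> carrier_mat n n"
  shows "(\<Sum>j<n. push P v j) = (\<Sum>i<n. v i)"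
proof -
  have "(\<Sum>j<n. push P v j) = (\<Sum>i<n. v i * (\<Sum>j<n. P $$ (i, j)))"
    unfolding push_def sum_distrib_left using assms by (subst sum.swap) simp
  then show ?thesis using stochastic_matD(2)[OF assms] by simp
qed

lemma push_contraction:
  assumes P: "stochastic_mat P" "P \<in> carrier_mat n n"
    and p: "\<And>x y. x < n \<Longrightarrow> y < n \<Longrightarrow> p \<le> P $$ (x, y)"
    and v: "(\<Sum>i<n. v i) = 0"
  shows "(\<Sum>j<n. \<bar>push P v j\<bar>) \<le> (1 - real n * p) * (\<Sum>i<n. \<bar>v i\<bar>)"
proof -
  \<comment> \<open>Since \<open>v\<close> sums to zero, subtracting the constant \<open>p\<close> from every entry does not change \<open>v P\<close>.\<close>
  have "push P v j = (\<Sum>i<n. v i * (P $$ (i, j) - p))" for j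
    using P(2) v by (simp add: push_def right_diff_distrib sum_subtractf flip: sum_distrib_right)
  then have "(\<Sum>j<n. \<bar>push P v j\<bar>) \<le> (\<Sum>j<n. \<Sum>i<n. \<bar>v i * (P $$ (i, j) - p)\<bar>)"
    by (simp add: sum_mono)
  \<comment> \<open>The reduced entries \<open>P - p\<close> are nonnegative, so the absolute value
    falls on \<open>v\<close> alone; each row of \<open>P - p\<close> sums to
    \<open>1 - n p\<close>.\<close>
  also have "\<dots> = (\<Sum>j<n. \<Sum>i<n. \<bar>v i\<bar> * (P $$ (i, j) - p))"
    by (intro sum.cong refl) (auto simp: abs_mult p)
  also have "\<dots> = (\<Sum>i<n. \<bar>v i\<bar> * (\<Sum>j<n. P $$ (i, j) - p))"
    by (subst sum.swap) (simp add: sum_distrib_left)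
  also have "\<dots> = (1 - real n * p) * (\<Sum>i<n. \<bar>v i\<bar>)"
    using stochastic_matD(2)[OF P] by (simp add: sum_subtractf sum_distrib_left mult.commute)
  finally show ?thesis .
qed

lemma push_pow_contraction:
  assumes P: "stochastic_mat P" "P \<in> carrier_mat n n" and n: "1 \<le> n"
    and v: "(\<Sum>i<n. v i) = 0"
  shows "(\<Sum>j<n. \<bar>push (P ^\<^sub>m t) v j\<bar>) \<le> (1 - real n * min_entry P) ^ t * (\<Sum>i<n. \<bar>v i\<bar>)"
proof (induction t)
  case 0
  have "push (1\<^sub>m n) v j = v j" if "j < n" for j
  proof -
    have "push (1\<^sub>m n) v j = (\<Sum>i<n. if i = j then v i else 0)"
      unfolding push_def using that by (intro sum.cong) auto
    then show ?thesis using that by simp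
  qed
  then show ?case using P by simp
next
  case (Suc t)
  let ?c = "1 - real n * min_entry P"
  have "(\<Sum>j<n. \<bar>push (P ^\<^sub>m Suc t) v j\<bar>) = (\<Sum>j<n. \<bar>push P (push (P ^\<^sub>m t) v) j\<bar>)"
    using P by (simp add: push_mult[of _ n])
  also have "\<dots> \<le> ?c * (\<Sum>j<n. \<bar>push (P ^\<^sub>m t) v j\<bar>)"
    by (rule push_contraction[OF P])
      (use P v min_entry_le[OF P(2)] sum_push[OF stochastic_mat_pow[OF P]] in auto)
  \<comment> \<open>Multiplying the induction hypothesis by \<open>?c\<close> needs
    \<open>?c \<ge> 0\<close>, that is, \<open>n p \<le> 1\<close>.\<close>
  also have "\<dots> \<le> ?c * (?c ^ t * (\<Sum>i<n. \<bar>v i\<bar>))"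
    using Suc min_entry_le_inverse_dim[OF P n] by (intro mult_left_mono) auto
  finally show ?case by (simp add: mult.assoc)
qed

section \<open>The stationary distribution\<close>

lemma is_stationary_dist_iff:
  assumes "P \<in> carrier_mat n n"
  shows "is_stationary_dist P \<pi> \<longleftrightarrow> \<pi> \<in> carrier_vec n \<and> (\<forall>x<n. 0 \<le> \<pi> $ x) \<and>
    (\<Sum>x<n. \<pi> $ x) = 1 \<and> (\<forall>j<n. push P (($) \<pi>) j = \<pi> $ j)"
proof -
  have "mat_of_row \<pi> * P = mat_of_row \<pi> \<longleftrightarrow> (\<forall>j<n. push P (($) \<pi>) j = \<pi> $ j)"
    if \<pi>: "\<pi> \<in> carrier_vec n"
  proof -
    have "(mat_of_row \<pi> * P) $$ (0, j) = push P (($) \<pi>) j" if "j < n" for j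
      using index_mult_mat_sum[of "mat_of_row \<pi>" 1 n P n 0 j] that \<pi> assms
      by (simp add: push_def mat_of_row_carrier)
    then show ?thesis
      using \<pi> assms by (auto simp: mat_eq_iff simp del: index_mult_mat(1))
  qed
  then show ?thesis using assms by (auto simp: is_stationary_dist_def)
qed

text \<open>Since \<open>P\<close> fixes the all-ones column, \<open>P - I\<close> is singular, and
  so is its transpose. This yields a nonzero row vector fixed by \<open>P\<close>; its entrywise
  absolute value is again fixed and can be normalised.\<close>

lemma stationary_dist_exists:
  assumes P: "stochastic_mat P" "P \<in> carrier_mat n n" and n: "1 \<le> n"
  shows "\<exists>\<pi>. is_stationary_dist P \<pi>"
proof -
  define A where "A = P - 1\<^sub>m n"
  have A: "A \<in> carrier_mat n n" by (simp add: A_def minus_carrier_mat)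
  let ?one = "vec n (\<lambda>_. 1 :: real)"
  have "A *\<^sub>v ?one = 0\<^sub>v n"
  proof (rule eq_vecI)
    fix i assume "i < dim_vec (0\<^sub>v n :: real vec)"
    then have i: "i < n" by simp
    have "(A *\<^sub>v ?one) $ i = (\<Sum>j<n. P $$ (i, j) - (if i = j then 1 else 0))"
      using i P A by (simp add: scalar_prod_def lessThan_atLeast0 A_def)
    also have "\<dots> = 0"
      using i stochastic_matD(2)[OF P i] by (simp add: sum_subtractf)
    finally show "(A *\<^sub>v ?one) $ i = 0\<^sub>v n $ i" using i by simp
  qed (use A in simp)
  moreover have "?one \<noteq> 0\<^sub>v n" using n by (auto simp: vec_eq_iff intro: exI[of _ 0])
  ultimately have "det A = 0"
    using det_0_iff_vec_prod_zero[OF A] by (metis vec_carrier)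
  then have "det (transpose_mat A) = 0" using det_transpose[OF A] by simp
  then obtain v where v: "v \<in> carrier_vec n" "v \<noteq> 0\<^sub>v n" "transpose_mat A *\<^sub>v v = 0\<^sub>v n"
    using det_0_iff_vec_prod_zero[of "transpose_mat A" n] A by auto
  \<comment> \<open>Coordinate \<open>j\<close> of the transposed kernel equation reads
    \<open>(v P) j - v j = 0\<close>.\<close>
  have fix_v: "push P (($) v) j = v $ j" if j: "j < n" for j
  proof -
    have "0 = (transpose_mat A *\<^sub>v v) $ j" using v j by simp
    also have "\<dots> = (\<Sum>i<n. (P $$ (i, j) - (if i = j then 1 else 0)) * v $ i)"
      using j v(1) A P by (simp add: scalar_prod_def lessThan_atLeast0 A_def)
    also have "\<dots> = (\<Sum>i<n. v $ i * P $$ (i, j)) - (\<Sum>i<n. if i = j then v $ i else 0)"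
      unfolding sum_subtractf[symmetric] by (intro sum.cong) (auto simp: algebra_simps)
    also have "\<dots> = push P (($) v) j - v $ j" using j P by (simp add: push_def)
    finally show ?thesis by simp
  qed
  let ?w = "\<lambda>i. \<bar>v $ i\<bar>"
  have le: "?w j \<le> push P ?w j" if "j < n" for j
  proof -
    have "?w j = \<bar>\<Sum>i<n. v $ i * P $$ (i, j)\<bar>" using fix_v[OF that] P by (simp add: push_def)
    also have "\<dots> \<le> (\<Sum>i<n. \<bar>v $ i * P $$ (i, j)\<bar>)" by (rule sum_abs)
    also have "\<dots> = push P ?w j"
      using P that stochastic_matD(1)[OF P] by (simp add: push_def abs_mult)
    finally show ?thesis .
  qed
  \<comment> \<open>The inequality \<open>\<bar>v\<bar> \<le> \<bar>v\<bar> P\<close> is an equality because both sides have the same total mass.\<close>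
  have "(\<Sum>j<n. push P ?w j - ?w j) = 0" using sum_push[OF P] by (simp add: sum_subtractf)
  then have eq: "push P ?w j = ?w j" if "j < n" for j
    using sum_nonneg_eq_0_iff[of "{..<n}" "\<lambda>j. push P ?w j - ?w j"] le that by auto
  define s where "s = (\<Sum>i<n. ?w i)"
  obtain i where "i < n" "v $ i \<noteq> 0" using v by (auto simp: vec_eq_iff)
  then have s: "0 < s" unfolding s_def by (intro sum_pos2[of _ i]) auto
  have "is_stationary_dist P (vec n (\<lambda>i. ?w i / s))"
    unfolding is_stationary_dist_iff[OF P(2)]
  proof (intro conjI allI impI)
    show "(\<Sum>x<n. vec n (\<lambda>i. ?w i / s) $ x) = 1"
      using s by (simp add: s_def flip: sum_divide_distrib)
  next
    fix j assume j: "j < n"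
    have "push P (($) (vec n (\<lambda>i. ?w i / s))) j = push P ?w j / s"
      using P by (simp add: push_def sum_divide_distrib)
    then show "push P (($) (vec n (\<lambda>i. ?w i / s))) j = vec n (\<lambda>i. ?w i / s) $ j"
      using eq j by simp
  qed (use s in auto)
  then show ?thesis ..
qed

lemma stationary_push_pow:
  assumes "P \<in> carrier_mat n n" "is_stationary_dist P \<pi>" "j < n"
  shows "push (P ^\<^sub>m t) (($) \<pi>) j = \<pi> $ j"
  using assms(3)
proof (induction t arbitrary: j)
  case 0
  have "push (1\<^sub>m n) (($) \<pi>) j = (\<Sum>i<n. if i = j then \<pi> $ i else 0)"
    unfolding push_def using 0 by (intro sum.cong) auto
  then show ?case using 0 assms(1) by simp
next
  case (Suc t)
  have "push (P ^\<^sub>m Suc t) (($) \<pi>) j = push P (push (P ^\<^sub>m t) (($) \<pi>)) j"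
    using Suc.prems assms(1) by (simp add: push_mult[of _ n])
  also have "\<dots> = push P (($) \<pi>) j"
    using Suc.IH assms(1) by (intro push_cong) auto
  also have "\<dots> = \<pi> $ j"
    using assms(1,2) Suc.prems is_stationary_dist_iff by blast
  finally show ?case .
qed

text \<open>The difference of two stationary distributions has zero sum and is fixed by the
  \<open>m\<close>-th power of \<open>P\<close>, which also contracts it by a factor below 1; hence
  it vanishes.\<close>

lemma stationary_dist_unique:
  assumes P: "stochastic_mat P" "P \<in> carrier_mat n n" and n: "1 \<le> n"
    and pos: "positive_mat (P ^\<^sub>m m)"
    and st: "is_stationary_dist P \<pi>" "is_stationary_dist P \<rho>"
  shows "\<pi> = \<rho>"
proof -
  let ?v = "\<lambda>i. \<pi> $ i - \<rho> $ i" and ?p = "min_entry (P ^\<^sub>m m)"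
  have Pm: "stochastic_mat (P ^\<^sub>m m)" "P ^\<^sub>m m \<in> carrier_mat n n"
    using stochastic_mat_pow[OF P] P(2) by auto
  have v0: "(\<Sum>i<n. ?v i) = 0"
    using st is_stationary_dist_iff[OF P(2)] by (simp add: sum_subtractf)
  have "(\<Sum>j<n. \<bar>?v j\<bar>) = (\<Sum>j<n. \<bar>push (P ^\<^sub>m m) ?v j\<bar>)"
    using stationary_push_pow[OF P(2)] st by (simp add: push_diff)
  also have "\<dots> \<le> (1 - real n * ?p) * (\<Sum>j<n. \<bar>?v j\<bar>)"
    by (rule push_contraction[OF Pm min_entry_le[OF Pm(2)] v0])
  finally have "real n * ?p * (\<Sum>j<n. \<bar>?v j\<bar>) \<le> 0" by (simp add: algebra_simps)
  moreover have "0 < real n * ?p" using min_entry_pos[OF pos Pm(2) n] n by simp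
  ultimately have "(\<Sum>j<n. \<bar>?v j\<bar>) \<le> 0" by (meson mult_pos_pos not_le)
  then have "(\<Sum>j<n. \<bar>?v j\<bar>) = 0" by (simp add: order_antisym sum_nonneg)
  then have "\<pi> $ i = \<rho> $ i" if "i < n" for i using that by (simp add: sum_nonneg_eq_0_iff)
  then show ?thesis using st is_stationary_dist_iff[OF P(2)] by (auto intro!: eq_vecI)
qed

text \<open>Existence and uniqueness together justify the definite description in
  \<open>stationary_dist\<close>.\<close>

lemma stationary_dist_is_stationary:
  assumes "stochastic_mat P" "P \<in> carrier_mat n n" "1 \<le> n" "positive_mat (P ^\<^sub>m m)"
  shows "is_stationary_dist P (stationary_dist P)"
  unfolding stationary_dist_def
  using stationary_dist_exists[OF assms(1-3)] stationary_dist_unique[OF assms]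
  by (metis theI)

text \<open>Row \<open>x\<close> of the power minus the stationary vector is the image of (point
  mass at \<open>x\<close>) minus (stationary vector). That difference has zero sum and norm at most
  2, which cancels the \<open>1/2\<close> in \<open>tv_dist\<close>.\<close>

lemma dist_from_stationarity_le:
  assumes P: "stochastic_mat P" "P \<in> carrier_mat n n" and n: "1 \<le> n"
    and pos: "positive_mat (P ^\<^sub>m m)"
  shows "dist_from_stationarity P (m * t) \<le> (1 - real n * min_entry (P ^\<^sub>m m)) ^ t"
proof -
  let ?\<pi> = "stationary_dist P" and ?c = "1 - real n * min_entry (P ^\<^sub>m m)"
  have Pm: "stochastic_mat (P ^\<^sub>m m)" "P ^\<^sub>m m \<in> carrier_mat n n"
    using stochastic_mat_pow[OF P] P(2) by auto
  note st = stationary_dist_is_stationary[OF assms]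
  have \<pi>: "\<forall>x<n. 0 \<le> ?\<pi> $ x" "(\<Sum>x<n. ?\<pi> $ x) = 1"
    using st is_stationary_dist_iff[OF P(2)] by auto
  have "tv_dist (row (P ^\<^sub>m (m * t)) x) ?\<pi> \<le> ?c ^ t" if x: "x < n" for x
  proof -
    let ?e = "\<lambda>i. if i = x then 1 else 0 :: real"
    let ?v = "\<lambda>i. ?e i - ?\<pi> $ i"
    have v0: "(\<Sum>i<n. ?v i) = 0" using x \<pi> by (simp add: sum_subtractf)
    have "(\<Sum>i<n. \<bar>?v i\<bar>) \<le> (\<Sum>i<n. ?e i + ?\<pi> $ i)"
      using \<pi>(1) by (intro sum_mono) auto
    also have "\<dots> = 2" using x \<pi>(2) by (simp add: sum.distrib)
    finally have v2: "(\<Sum>i<n. \<bar>?v i\<bar>) \<le> 2" .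
    have "push (P ^\<^sub>m (m * t)) ?e j = (P ^\<^sub>m (m * t)) $$ (x, j)" for j
    proof -
      have "push (P ^\<^sub>m (m * t)) ?e j = (\<Sum>i<n. if i = x then (P ^\<^sub>m (m * t)) $$ (i, j) else 0)"
        unfolding push_def using P by (intro sum.cong) auto
      then show ?thesis using x by simp
    qed
    then have "tv_dist (row (P ^\<^sub>m (m * t)) x) ?\<pi> = 1 / 2 * (\<Sum>j<n. \<bar>push (P ^\<^sub>m (m * t)) ?v j\<bar>)"
      using x P stationary_push_pow[OF P(2) st] by (simp add: tv_dist_def push_diff)
    also have "(\<Sum>j<n. \<bar>push (P ^\<^sub>m (m * t)) ?v j\<bar>) \<le> ?c ^ t * (\<Sum>i<n. \<bar>?v i\<bar>)"
      unfolding pow_mat_mult[OF P(2)] by (rule push_pow_contraction[OF Pm n v0])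
    also have "\<dots> \<le> ?c ^ t * 2"
      using v2 min_entry_le_inverse_dim[OF Pm n] by (intro mult_left_mono) auto
    finally show ?thesis by simp
  qed
  then show ?thesis
    unfolding dist_from_stationarity_def using P n
    by (subst Max_le_iff) (auto simp: lessThan_empty_iff)
qed

section \<open>Ergodic chains have a positive power\<close>

text \<open>Applied below to the possible return times of a state. Gcd 1 forces two consecutive
  elements \<open>a\<close> and \<open>a + 1\<close> in \<open>S\<close>, and these generate every
  number from \<open>a * a\<close> on.\<close>

lemma nat_semigroup_gcd_1_cofinite:
  fixes S :: "nat set"
  assumes "0 \<in> S" and add: "\<And>a b. a \<in> S \<Longrightarrow> b \<in> S \<Longrightarrow> a + b \<in> S" and "Gcd S = 1"
  shows "\<exists>N. \<forall>k\<ge>N. k \<in> S"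
proof -
  have mult: "k * a \<in> S" if "a \<in> S" for k a
    by (induction k) (use assms(1) that add in auto)
  \<comment> \<open>The least positive difference of two elements of \<open>S\<close> divides every element of \<open>S\<close>,
    so it is 1.\<close>
  define D where "D = {int b - int a | a b. a \<in> S \<and> b \<in> S}"
  have S_D: "int a \<in> D" if "a \<in> S" for a
    unfolding D_def using that assms(1) by force
  have D_diff: "x - y \<in> D" if "x \<in> D" "y \<in> D" for x y
  proof -
    from that obtain a b c d where "a \<in> S" "b \<in> S" "c \<in> S" "d \<in> S" "x = int b - int a" "y = int d - int c"
      unfolding D_def by blast
    then have "x - y = int (b + c) - int (a + d)" "a + d \<in> S" "b + c \<in> S" by (auto intro: add)
    then show ?thesis unfolding D_def by blast
  qed
  have D_mult_diff: "x - int k * y \<in> D" if "x \<in> D" "y \<in> D" for x y k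
  proof (induction k)
    case (Suc k)
    have "x - int (Suc k) * y = (x - int k * y) - y" by (simp add: algebra_simps)
    then show ?case using D_diff[OF Suc that(2)] by (simp only:)
  qed (use that in simp)
  \<comment> \<open>Gcd 1 excludes that \<open>S\<close> contains only 0, so the
    \<open>LEAST\<close> below ranges over a nonempty set.\<close>
  obtain s where s: "s \<in> S" "0 < s" using assms(3) Gcd_0_iff[of S] by fastforce
  define d where "d = (LEAST d. 0 < d \<and> int d \<in> D)"
  have d: "0 < d" "int d \<in> D"
    unfolding d_def using LeastI[of "\<lambda>d. 0 < d \<and> int d \<in> D" s] s S_D by auto
  have "d dvd a" if "a \<in> S" for a
  proof -
    \<comment> \<open>Euclidean division: the remainder lies in \<open>D\<close> and is smaller than
      \<open>d\<close>, so minimality of \<open>d\<close> makes it 0.\<close>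
    have "int (a mod d) = int a - int (a div d) * int d"
      by (simp add: zmod_int zdiv_int minus_div_mult_eq_mod)
    then have "int (a mod d) \<in> D" using D_mult_diff[OF S_D[OF that] d(2)] by simp
    then have "a mod d = 0"
      using not_less_Least[of "a mod d" "\<lambda>d. 0 < d \<and> int d \<in> D"] d(1)
      by (auto simp: d_def[symmetric])
    then show ?thesis by auto
  qed
  then have "d = 1" using assms(3) by (metis Gcd_greatest nat_dvd_1_iff_1)
  then obtain a b where ab: "a \<in> S" "b \<in> S" "int 1 = int b - int a"
    using d(2) unfolding D_def by blast
  then have b: "b = Suc a" by linarith
  have a: "a \<in> S" "Suc a \<in> S" using ab(1,2) unfolding b by simp_all
  have "k \<in> S" if k: "k \<ge> a * a" for k
  proof (cases "a = 0")
    case True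
    then show ?thesis using mult[OF a(2), of k] by simp
  next
    case False
    \<comment> \<open>Division by \<open>a\<close> gives \<open>k = q a + r = (q - r) a + r (a + 1)\<close> with \<open>r < a \<le> q\<close>.\<close>
    have "a \<le> k div a" using k False by (simp add: less_eq_div_iff_mult_less_eq)
    moreover have "k mod a < a" using False by simp
    ultimately obtain c where c: "k div a = k mod a + c"
      using le_Suc_ex by (metis less_imp_le order_trans)
    have "k = (k div a) * a + k mod a" by simp
    also have "\<dots> = c * a + (k mod a) * Suc a" unfolding c by (simp add: algebra_simps)
    finally show ?thesis using mult[OF a(1)] mult[OF a(2)] add by metis
  qed
  then show ?thesis by blast
qed

text \<open>Passing through \<open>y\<close> contributes a positive term to a sum of nonnegative
  ones.\<close>

lemma pow_mat_pos_trans: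
  assumes P: "stochastic_mat P" "P \<in> carrier_mat n n" and "x < n" "y < n" "z < n"
    and "0 < (P ^\<^sub>m k) $$ (x, y)" "0 < (P ^\<^sub>m l) $$ (y, z)"
  shows "0 < (P ^\<^sub>m (k + l)) $$ (x, z)"
proof -
  have C: "P ^\<^sub>m i \<in> carrier_mat n n" for i using P by simp
  have "(P ^\<^sub>m (k + l)) $$ (x, z) = (\<Sum>i<n. (P ^\<^sub>m k) $$ (x, i) * (P ^\<^sub>m l) $$ (i, z))"
    unfolding pow_mat_add[OF P(2)] by (rule index_mult_mat_sum[OF C C assms(3,5)])
  also have "\<dots> > 0"
    using assms by (intro sum_pos2[of _ y] mult_pos_pos mult_nonneg_nonneg)
      (auto intro!: stochastic_matD(1)[OF stochastic_mat_pow[OF P] C])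
  finally show ?thesis .
qed

text \<open>Each arc is a positive entry of \<open>P\<close>, and positivity composes along the
  walk. The bound on \<open>y\<close> is carried through the induction because
  \<open>pow_mat_pos_trans\<close> asks for it.\<close>

lemma awalk_pow_mat_pos:
  assumes P: "stochastic_mat P" "P \<in> carrier_mat n n"
    and "pre_digraph.awalk (with_proj (transition_graph P)) x w y"
  shows "y < n \<and> 0 < (P ^\<^sub>m length w) $$ (x, y)"
  using assms(3)
proof (induction w arbitrary: x)
  case Nil
  then show ?case
    using P by (auto simp: pre_digraph.awalk_def pre_digraph.cas.simps transition_graph_def)
next
  case (Cons e w)
  obtain z where e: "e = (x, z)" and xz: "x < n" "z < n" "0 < P $$ (x, z)"
    and w: "pre_digraph.awalk (with_proj (transition_graph P)) z w y"
    using Cons.prems P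
    by (cases e) (auto simp: pre_digraph.awalk_def pre_digraph.cas.simps transition_graph_def)
  have "0 < (P ^\<^sub>m 1) $$ (x, z)" using xz P by simp
  then show ?case
    using pow_mat_pos_trans[OF P xz(1,2) _ _ , of y 1 "length w"] Cons.IH[OF w] by simp
qed

text \<open>Aperiodicity makes every diagonal entry positive for all large exponents; irreducibility
  supplies a walk from \<open>x\<close> to \<open>y\<close> to append. Finitely many pairs then
  share one exponent.\<close>

lemma ergodic_chain_positive_power:
  assumes Q: "ergodic_chain Q" "Q \<in> carrier_mat n n"
  shows "\<exists>k\<ge>1. positive_mat (Q ^\<^sub>m k)"
proof -
  let ?G = "with_proj (transition_graph Q)"
  have P: "stochastic_mat Q" using Q by (simp add: ergodic_chain_def)
  interpret pair_wf_digraph "transition_graph Q"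
    by unfold_locales (auto simp: transition_graph_def)
  have loops: "\<exists>N. \<forall>k\<ge>N. 0 < (Q ^\<^sub>m k) $$ (x, x)" if x: "x < n" for x
  proof -
    let ?S = "{k. 0 < (Q ^\<^sub>m k) $$ (x, x)}"
    \<comment> \<open>\<open>?S\<close> contains all lengths of closed walks at \<open>x\<close>, so
      its gcd divides theirs.\<close>
    have "Gcd ?S dvd Gcd {length w | w. awalk x w x \<and> w \<noteq> []}"
      using awalk_pow_mat_pos[OF P Q(2)] by (intro Gcd_greatest Gcd_dvd) auto
    also have "\<dots> = 1" using Q x by (auto simp: ergodic_chain_def aperiodic_chain_def)
    finally have "Gcd ?S = 1" by simp
    moreover have "0 \<in> ?S" using x Q by simp
    ultimately show ?thesis
      using nat_semigroup_gcd_1_cofinite[of ?S] pow_mat_pos_trans[OF P Q(2) x x x] by auto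
  qed
  have ex: "\<exists>N. \<forall>k\<ge>N. 0 < (Q ^\<^sub>m k) $$ (x, y)" if xy: "x < n" "y < n" for x y
  proof -
    obtain N where N: "\<And>k. k \<ge> N \<Longrightarrow> 0 < (Q ^\<^sub>m k) $$ (x, x)" using loops xy by blast
    have "x \<rightarrow>\<^sup>*\<^bsub>?G\<^esub> y"
      using Q xy by (auto simp: ergodic_chain_def irreducible_chain_def strongly_connected_def
          transition_graph_def)
    then obtain w where w: "awalk x w y" using reachable_awalk by auto
    \<comment> \<open>Spend \<open>k - length w\<close> steps returning to \<open>x\<close>, then
      follow \<open>w\<close>.\<close>
    have "0 < (Q ^\<^sub>m k) $$ (x, y)" if "k \<ge> N + length w" for k
      using pow_mat_pos_trans[OF P Q(2) xy(1,1,2) N, of "k - length w" "length w"]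
        awalk_pow_mat_pos[OF P Q(2) w] that by simp
    then show ?thesis by blast
  qed
  then obtain N where N: "\<And>x y k. x < n \<Longrightarrow> y < n \<Longrightarrow> k \<ge> N x y \<Longrightarrow> 0 < (Q ^\<^sub>m k) $$ (x, y)"
    by metis
  \<comment> \<open>The sum dominates every threshold, and \<open>Suc\<close> ensures an exponent of
    at least 1.\<close>
  define K where "K = Suc (\<Sum>x<n. \<Sum>y<n. N x y)"
  have "N x y \<le> K" if "x < n" "y < n" for x y
  proof -
    have "N x y \<le> (\<Sum>y<n. N x y)" using that by (intro member_le_sum) auto
    also have "\<dots> \<le> (\<Sum>x<n. \<Sum>y<n. N x y)"
      using that by (intro member_le_sum[of x _ "\<lambda>x. \<Sum>y<n. N x y"]) auto
    finally show ?thesis by (simp add: K_def)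
  qed
  then have "positive_mat (Q ^\<^sub>m K)"
    using Q(2) N elements_matD[of _ "Q ^\<^sub>m K"] unfolding positive_mat_def
    by (metis carrier_matD pow_carrier_mat)
  moreover have "1 \<le> K" by (simp add: K_def)
  ultimately show ?thesis by blast
qed

section \<open>Mixing time\<close>

text \<open>For \<open>n \<ge> 2\<close>, \<open>1 - n p \<le> exp (- 2 p)\<close>, which is the
  source of the 2 in the bound on \<open>t\<close>; the power is then at most
  \<open>\<epsilon> / n\<close>. A single state is treated apart, as there \<open>n p\<close> is
  only \<open>p\<close>.\<close>

lemma doeblin_power_le:
  fixes p \<epsilon> :: real
  assumes "1 \<le> n" "0 < p" "real n * p \<le> 1" "0 < \<epsilon>" "1 \<le> t"
    and t: "1 / (2 * p) * ln (real n / \<epsilon>) \<le> real t"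
    and single: "n = 1 \<Longrightarrow> p = 1"
  shows "(1 - real n * p) ^ t \<le> \<epsilon>"
proof (cases "n = 1")
  case True
  \<comment> \<open>The base is 0, and \<open>1 \<le> t\<close> rules out the value
    \<open>0 ^ 0 = 1\<close>.\<close>
  then show ?thesis using single assms by (simp add: power_0_left)
next
  case False
  then have n: "2 \<le> real n" using assms(1) by simp
  have "1 - real n * p \<le> exp (- (real n * p))"
    using exp_ge_add_one_self[of "- (real n * p)"] by simp
  also have "\<dots> \<le> exp (- (2 * p))" using n assms(2) by simp
  finally have "(1 - real n * p) ^ t \<le> exp (- (2 * p)) ^ t"
    using assms by (intro power_mono) auto
  also have "\<dots> = exp (- (2 * p * real t))" by (simp flip: exp_of_nat_mult)
  also have "\<dots> \<le> exp (- ln (real n / \<epsilon>))"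
    using t assms(2) by (simp add: field_simps)
  also have "\<dots> = \<epsilon> / real n" using n assms by (simp add: exp_minus)
  also have "\<dots> \<le> \<epsilon>" using n assms by (simp add: field_simps)
  finally show ?thesis .
qed

lemma min_entry_single_state:
  assumes "stochastic_mat P" "P \<in> carrier_mat 1 1"
  shows "min_entry P = 1"
proof -
  have "elements_mat P = {P $$ (0, 0)}" using assms by auto
  then show ?thesis using stochastic_matD(2)[OF assms, of 0] by (simp add: min_entry_def)
qed

text \<open>Common core of both bounds: \<open>m = 1\<close> serves positive matrices, and the first
  positive power serves ergodic chains.\<close>

lemma dist_from_stationarity_le_eps:
  assumes P: "stochastic_mat P" "P \<in> carrier_mat n n" and n: "1 \<le> n"
    and pos: "positive_mat (P ^\<^sub>m m)"
    and "0 < \<epsilon>" "1 \<le> t" "1 / (2 * min_entry (P ^\<^sub>m m)) * ln (real n / \<epsilon>) \<le> real t"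
  shows "dist_from_stationarity P (m * t) \<le> \<epsilon>"
proof -
  have Pm: "stochastic_mat (P ^\<^sub>m m)" "P ^\<^sub>m m \<in> carrier_mat n n"
    using stochastic_mat_pow[OF P] P(2) by auto
  have "(1 - real n * min_entry (P ^\<^sub>m m)) ^ t \<le> \<epsilon>"
    using assms min_entry_pos[OF pos Pm(2) n] min_entry_le_inverse_dim[OF Pm n] Pm
    by (intro doeblin_power_le) (auto intro!: min_entry_single_state)
  then show ?thesis using dist_from_stationarity_le[OF P n pos, of t] by linarith
qed

lemma mixing_time_le:
  assumes Q: "ergodic_chain Q" "Q \<in> carrier_mat n n" and n: "1 \<le> n"
    and m: "m = positivity_exponent Q" and \<epsilon>: "0 < \<epsilon>" "\<epsilon> < 1"
  shows "real (mixing_time Q \<epsilon>) \<le> 3 * (real m / (2 * min_entry (Q ^\<^sub>m m))) * ln (real n / \<epsilon>)"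
proof -
  have P: "stochastic_mat Q" using Q by (simp add: ergodic_chain_def)
  have "1 \<le> m \<and> positive_mat (Q ^\<^sub>m m)"
    unfolding m positivity_exponent_def
    by (rule LeastI_ex[OF ergodic_chain_positive_power[OF Q]])
  then have pos: "positive_mat (Q ^\<^sub>m m)" by simp
  let ?p = "min_entry (Q ^\<^sub>m m)"
  have Qm: "stochastic_mat (Q ^\<^sub>m m)" "Q ^\<^sub>m m \<in> carrier_mat n n"
    using stochastic_mat_pow[OF P Q(2)] Q(2) by auto
  have p: "0 < ?p" using min_entry_pos[OF pos Qm(2) n] .
  have np: "real n * ?p \<le> 1" using min_entry_le_inverse_dim[OF Qm n] .
  have ln_nonneg: "0 \<le> ln (real n / \<epsilon>)" using n \<epsilon> by simp
  show ?thesis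
  proof (cases "n = 1")
    case True
    \<comment> \<open>Here \<open>ln (n / \<epsilon>)\<close> may be arbitrarily small, but the chain is mixed at time \<open>0\<close>.\<close>
    have "dist_from_stationarity Q 0 = dist_from_stationarity Q (m * 1)"
    proof -
      \<comment> \<open>The only stochastic matrix of size 1 is the identity, which is also the
        zeroth power of \<open>Q\<close>.\<close>
      have "Q ^\<^sub>m m = 1\<^sub>m 1"
        using Qm True stochastic_matD(2)[OF Qm, of 0] by (auto simp: mat_eq_iff)
      then show ?thesis using Q(2) True by (simp add: dist_from_stationarity_def)
    qed
    also have "\<dots> \<le> 0"
      using dist_from_stationarity_le[OF P Q(2) n pos, of 1] min_entry_single_state[of "Q ^\<^sub>m m"]
        Qm True by simp
    finally have "mixing_time Q \<epsilon> \<le> 0"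
      unfolding mixing_time_def using \<epsilon> by (intro Least_le) simp
    then show ?thesis using p ln_nonneg by simp
  next
    case False
    then have n2: "2 \<le> real n" using n by simp
    define L where "L = ln (real n / \<epsilon>) / (2 * ?p)"
    have "?p \<le> 1 / 2" using np p mult_right_mono[OF n2, of ?p] by linarith
    have "2 \<le> real n / \<epsilon>" using n2 \<epsilon> by (simp add: field_simps)
    then have "ln 2 \<le> ln (real n / \<epsilon>)" using n2 \<epsilon> by (subst ln_le_cancel_iff) auto
    \<comment> \<open>This is \<open>ln x \<le> x - 1\<close> at \<open>x = 1/2\<close>.\<close>
    moreover have "1 / 2 \<le> ln (2 :: real)"
      using ln_le_minus_one[of "1 / 2 :: real"] by (simp add: ln_div)
    ultimately have "1 / 2 \<le> ln (real n / \<epsilon>)" by linarith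
    \<comment> \<open>Dividing by \<open>2 p \<le> 1\<close> does not decrease a nonnegative
      number.\<close>
    also have "\<dots> \<le> L"
      using ln_nonneg p \<open>?p \<le> 1 / 2\<close> mult_left_mono[of "2 * ?p" 1 "ln (real n / \<epsilon>)"]
      by (simp add: L_def field_simps)
    finally have L: "1 / 2 \<le> L" .
    define t where "t = nat \<lceil>L\<rceil>"
    have t: "1 \<le> t" "L \<le> real t" "real t \<le> L + 1" using L unfolding t_def by linarith+
    have "dist_from_stationarity Q (m * t) \<le> \<epsilon>"
      using t L_def by (intro dist_from_stationarity_le_eps[OF P Q(2) n pos \<epsilon>(1)]) auto
    then have "mixing_time Q \<epsilon> \<le> m * t" unfolding mixing_time_def by (rule Least_le)
    then have "real (mixing_time Q \<epsilon>) \<le> real m * real t" by (metis of_nat_le_iff of_nat_mult)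
    \<comment> \<open>The constant 3 arises here: \<open>L \<ge> 1/2\<close> gives
      \<open>t \<le> L + 1 \<le> 3 L\<close>.\<close>
    also have "\<dots> \<le> real m * (3 * L)" using t L by (intro mult_left_mono) auto
    finally show ?thesis by (simp add: L_def)
  qed
qed

theorem mainTheorem1:
  shows "(\<forall>(n::nat) (P::real mat) (\<epsilon>::real) (t::nat).
            1 \<le> n \<and> P \<in> carrier_mat n n \<and> stochastic_mat P \<and> positive_mat P \<and>
            0 < \<epsilon> \<and> \<epsilon> < 1 \<and> 1 \<le> t \<and>
            real t \<ge> 1 / (2 * min_entry P) * ln (real n / \<epsilon>) + 1
            \<longrightarrow> dist_from_stationarity P t \<le> \<epsilon>)
       \<and> (\<exists>C::real. 0 < C \<and>
            (\<forall>(n::nat) (Q::real mat) (m::nat) (\<epsilon>::real).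
               1 \<le> n \<and> Q \<in> carrier_mat n n \<and> ergodic_chain Q \<and>
               m = positivity_exponent Q \<and> 0 < \<epsilon> \<and> \<epsilon> < 1
               \<longrightarrow> real (mixing_time Q \<epsilon>)
                     \<le> C * (real m / (2 * min_entry (Q ^\<^sub>m m))) * ln (real n / \<epsilon>)))"
proof (intro conjI exI[of _ 3] allI impI)
  fix n t :: nat and P :: "real mat" and \<epsilon> :: real
  assume A: "1 \<le> n \<and> P \<in> carrier_mat n n \<and> stochastic_mat P \<and> positive_mat P \<and>
    0 < \<epsilon> \<and> \<epsilon> < 1 \<and> 1 \<le> t \<and> real t \<ge> 1 / (2 * min_entry P) * ln (real n / \<epsilon>) + 1"
  \<comment> \<open>Positivity of \<open>P\<close> itself is positivity of its first power, so the
    general bound applies with \<open>m = 1\<close>.\<close>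
  then have "P ^\<^sub>m 1 = P" by simp
  then show "dist_from_stationarity P t \<le> \<epsilon>"
    using A dist_from_stationarity_le_eps[of P n 1 \<epsilon> t] by simp
qed (use mixing_time_le in auto)

end
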